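(* Let $a_1/b_1,\ldots,a_k/b_k$ be $k$ rational numbers, with $a_i\in\mathbb{Z}$, $b_i$ positive integers and $\gcd(a_i,b_i)=1$ for $i=1,\ldots,k$. Then there exist a positive integer $n$ and a monic polynomial $f$ of degree $n$ with integer coefficients such that $$f\!\left(\frac{a_i}{b_i}\right)=\frac{1}{b_i^{\,n}},\qquad i=1,\ldots,k.$$ *)

theory Defs
  imports "HOL-Computational_Algebra.Computational_Algebra"
begin

end

theory Submission
  imports Defs "HOL-Number_Theory.Residues"
begin

text \<open>
  Clearing denominators turns \<open>f\<close> into a binary form \<open>F\<close>, and the claim says that \<open>F\<close> takes the
  value 1 at the primitive points \<open>(a\<^sub>i, b\<^sub>i)\<close> and, \<open>f\<close> being monic, at \<open>(1, 0)\<close>.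
  Add the points one at a time. If \<open>F\<close> is 1 at the old points, let \<open>G\<close> be the product of \<open>y\<close> and
  the linear forms \<open>b\<^sub>j x - a\<^sub>j y\<close>, which vanishes at all of them. At the new point \<open>p\<close> the integers
  \<open>F(p)\<close> and \<open>G(p)\<close> are coprime, so Euler's theorem gives \<open>K\<close> with \<open>F(p)^K = 1 + C G(p)\<close>, and
  \<open>F^K - C G l^r\<close> works for a linear form \<open>l\<close> with \<open>l(p) = 1\<close> and the appropriate \<open>r\<close>.
\<close>

text \<open>The value at \<open>(a, b)\<close> of the binary form of degree \<open>n\<close>
  obtained by homogenizing \<open>f\<close>. The formal degree \<open>n\<close> may exceed
  \<open>degree f\<close>; each surplus degree amounts to a factor \<open>y\<close>.\<close>

definition hom_eval :: "nat \<Rightarrow> int poly \<Rightarrow> int \<Rightarrow> int \<Rightarrow> int" where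
  "hom_eval n f a b = (\<Sum>i\<le>n. poly.coeff f i * a ^ i * b ^ (n - i))"

lemma of_int_hom_eval:
  assumes "degree f \<le> n" "b \<noteq> 0"
  shows "rat_of_int (hom_eval n f a b) =
    of_int b ^ n * poly (map_poly of_int f) (of_int a / of_int b)"
proof -
  have "degree (map_poly rat_of_int f) \<le> n"
    using assms(1) by (simp add: degree_map_poly)
  then have "poly (map_poly of_int f) (of_int a / of_int b :: rat) =
      (\<Sum>i\<le>n. of_int (poly.coeff f i) * (of_int a / of_int b) ^ i)"
    by (auto simp: poly_altdef coeff_map_poly coeff_eq_0 degree_map_poly le_degree
        intro!: sum.mono_neutral_left)
  moreover have "of_int (poly.coeff f i * a ^ i * b ^ (n - i)) =
      rat_of_int b ^ n * (of_int (poly.coeff f i) * (of_int a / of_int b) ^ i)" if "i \<le> n" for i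
  proof -
    have "rat_of_int b ^ n = of_int b ^ i * of_int b ^ (n - i)"
      using that by (simp flip: power_add)
    then show ?thesis
      using assms(2) by (simp add: power_divide)
  qed
  ultimately show ?thesis
    unfolding hom_eval_def of_int_sum by (simp only: sum_distrib_left) (rule sum.cong, auto)
qed

text \<open>For nonzero \<open>b\<close> both sides are the same multiple of the value of
  \<open>f * g\<close> at the rational a/b, so no convolution of coefficients has to be
  expanded.\<close>

lemma hom_eval_mult:
  assumes "degree f \<le> m" "degree g \<le> n" "b \<noteq> 0"
  shows "hom_eval (m + n) (f * g) a b = hom_eval m f a b * hom_eval n g a b"
proof -
  have "degree (f * g) \<le> m + n"
    using assms degree_mult_le[of f g] by linarith
  moreover have "map_poly rat_of_int (f * g) = map_poly of_int f * map_poly of_int g"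
    by (intro poly_eqI) (simp add: coeff_map_poly coeff_mult)
  ultimately have "rat_of_int (hom_eval (m + n) (f * g) a b) =
      of_int (hom_eval m f a b * hom_eval n g a b)"
    using assms by (simp add: of_int_hom_eval power_add)
  then show ?thesis
    by (simp only: of_int_eq_iff)
qed

text \<open>This is how the factor \<open>y\<close> of the form G arises: it is invisible in the
  polynomial and only raises the formal degree.\<close>

lemma hom_eval_Suc:
  assumes "degree f \<le> n"
  shows "hom_eval (Suc n) f a b = b * hom_eval n f a b"
  using assms by (auto simp: hom_eval_def coeff_eq_0 sum_distrib_left Suc_diff_le intro!: sum.cong)

lemma hom_eval_diff: "hom_eval n (f - g) a b = hom_eval n f a b - hom_eval n g a b"
  by (simp add: hom_eval_def sum_subtractf algebra_simps)

lemma hom_eval_smult: "hom_eval n (Polynomial.smult c f) a b = c * hom_eval n f a b"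
  by (simp add: hom_eval_def sum_distrib_left mult_ac)

lemma hom_eval_linear: "hom_eval 1 [:v, u:] a b = v * b + u * a"
  by (simp add: hom_eval_def)

lemma hom_eval_power:
  assumes "degree f \<le> n" "b \<noteq> 0"
  shows "hom_eval (n * K) (f ^ K) a b = hom_eval n f a b ^ K"
proof (induction K)
  case 0
  show ?case by (simp add: hom_eval_def)
next
  case (Suc K)
  have "degree (f ^ K) \<le> n * K"
    using degree_power_le[of f K] mult_le_mono1[OF assms(1), of K] by (rule order_trans)
  then show ?case
    using hom_eval_mult[OF assms(1) _ assms(2), of "f ^ K" "n * K" a] Suc by simp
qed

lemma degree_prod_linear_le:
  "degree (\<Prod>(c, d)\<in>S. [:- c, d :: int:]) \<le> card S"
proof (cases "finite S")
  case True
  have "degree (\<Prod>(c, d)\<in>S. [:- c, d:]) \<le> (\<Sum>p\<in>S. degree (case p of (c, d) \<Rightarrow> [:- c, d:]))"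
    using degree_prod_sum_le[OF True] by (simp add: o_def)
  also have "\<dots> \<le> (\<Sum>p\<in>S. 1)"
    by (intro sum_mono) auto
  finally show ?thesis by simp
\<comment> \<open>For infinite \<open>S\<close> the product is 1 and the cardinality 0.\<close>
qed simp

lemma hom_eval_prod_linear:
  assumes "finite S" "b \<noteq> 0"
  shows "hom_eval (card S) (\<Prod>(c, d)\<in>S. [:- c, d:]) a b = (\<Prod>(c, d)\<in>S. d * a - c * b)"
  using assms(1)
proof induction
  case empty
  show ?case by (simp add: hom_eval_def)
next
  case (insert p S)
  have "hom_eval (1 + card S) ((case p of (c, d) \<Rightarrow> [:- c, d:]) * (\<Prod>(c, d)\<in>S. [:- c, d:])) a b =
      hom_eval 1 (case p of (c, d) \<Rightarrow> [:- c, d:]) a b * hom_eval (card S) (\<Prod>(c, d)\<in>S. [:- c, d:]) a b"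
    using assms(2) degree_prod_linear_le by (intro hom_eval_mult) (auto split: prod.split)
  then show ?case
    using insert by (simp add: hom_eval_linear[unfolded One_nat_def] split: prod.splits)
qed

lemma hom_eval_cong:
  assumes "[a = a'] (mod d)" "[b = b'] (mod d)"
  shows "[hom_eval n f a b = hom_eval n f a' b'] (mod d)"
  unfolding hom_eval_def using assms by (intro cong_sum cong_mult cong_pow cong_refl)

lemma hom_eval_scale: "hom_eval n f (c * a) (c * b) = c ^ n * hom_eval n f a b"
proof -
  have "poly.coeff f i * (c * a) ^ i * (c * b) ^ (n - i) =
      c ^ n * (poly.coeff f i * a ^ i * b ^ (n - i))"
    if "i \<le> n" for i
  proof -
    have "c ^ n = c ^ i * c ^ (n - i)"
      using that by (simp flip: power_add)
    then show ?thesis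
      by (simp add: power_mult_distrib)
  qed
  then show ?thesis
    unfolding hom_eval_def sum_distrib_left by (intro sum.cong) auto
qed

text \<open>Modulo \<open>b\<close> only the top term \<open>a ^ n\<close> survives, and it is a
  unit.\<close>

lemma coprime_hom_eval_denominator:
  assumes "lead_coeff f = 1" "degree f = n" "coprime a b"
  shows "coprime (hom_eval n f a b) b"
proof -
  have "[hom_eval n f a b = hom_eval n f a 0] (mod b)"
    by (intro hom_eval_cong) (auto simp: cong_def)
  also have "hom_eval n f a 0 = (\<Sum>i\<le>n. if i = n then a ^ n else 0)"
    unfolding hom_eval_def using assms(1,2) by (intro sum.cong) auto
  finally have "[a ^ n = hom_eval n f a b] (mod b)"
    by (simp add: cong_sym_eq)
  moreover have "coprime (a ^ n) b"
    using assms(3) by simp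
  ultimately show ?thesis
    by (rule cong_imp_coprime)
qed

text \<open>Modulo the determinant of two primitive points, the first is a unit multiple of the second.\<close>

lemma coprime_hom_eval_determinant:
  assumes "coprime a b" "coprime c d" "hom_eval n f c d = 1"
  shows "coprime (hom_eval n f a b) (d * a - c * b)"
proof -
  obtain s t where st: "s * c + t * d = 1"
    using assms(2) bezout_int[of c d] by (auto simp: coprime_iff_gcd_eq_1)
  \<comment> \<open>The linear form s x + t y is 1 at \<open>(c, d)\<close>; its value
    \<open>u\<close> at \<open>(a, b)\<close> is the multiplier with (a, b) congruent to u (c, d)
    modulo the determinant. A common divisor of \<open>u\<close> and the determinant then divides
    both \<open>a\<close> and \<open>b\<close>.\<close>
  define u where "u = s * a + t * b"
  have a: "a = u * c + t * (d * a - c * b)"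
  proof -
    have "u * c + t * (d * a - c * b) = (s * c + t * d) * a"
      by (simp add: u_def algebra_simps)
    then show ?thesis using st by simp
  qed
  have b: "b = u * d - s * (d * a - c * b)"
  proof -
    have "u * d - s * (d * a - c * b) = (s * c + t * d) * b"
      by (simp add: u_def algebra_simps)
    then show ?thesis using st by simp
  qed
  have "coprime u (d * a - c * b)"
  proof (rule coprimeI)
    fix q assume "q dvd u" "q dvd d * a - c * b"
    then have "q dvd a" "q dvd b"
      by (subst a, simp, subst b, simp)
    then show "is_unit q"
      using assms(1) coprime_common_divisor by blast
  qed
  then have "coprime (u ^ n) (d * a - c * b)"
    by simp
  moreover have "[u * c = a] (mod d * a - c * b)" "[u * d = b] (mod d * a - c * b)"
    by (subst a, simp add: cong_iff_dvd_diff, subst b, simp add: cong_iff_dvd_diff)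
  then have "[u ^ n = hom_eval n f a b] (mod d * a - c * b)"
    using hom_eval_cong hom_eval_scale[of n f u c d] assms(3) by (metis mult.right_neutral)
  ultimately show ?thesis
    using cong_imp_coprime by blast
qed

text \<open>Proportional primitive points agree up to sign, and positive second coordinates fix the
  sign. Hence the determinant of two distinct points is nonzero.\<close>

lemma primitive_points_eqI:
  fixes a b c d :: int
  assumes "coprime a b" "coprime c d" "b > 0" "d > 0" "d * a = c * b"
  shows "a = c \<and> b = d"
proof -
  have "d dvd b"
    using assms(2) dvd_triv_left[of d a] unfolding assms(5)
    by (simp add: coprime_dvd_mult_right_iff coprime_commute)
  moreover have "b dvd d"
    using assms(1) dvd_triv_right[of b c] unfolding assms(5)[symmetric]
    by (simp add: coprime_dvd_mult_left_iff coprime_commute)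
  ultimately have "b = d"
    using assms by (simp add: zdvd_antisym_nonneg)
  then show ?thesis
    using assms by simp
qed

lemma exists_power_cong_1:
  fixes x m :: int
  assumes "coprime x m" "m \<noteq> 0"
  shows "\<exists>k>0. [x ^ k = 1] (mod m)"
proof -
  define N where "N = nat \<bar>m\<bar>"
  have "N > 0" using assms by (simp add: N_def)
  \<comment> \<open>\<open>euler_theorem\<close> concerns natural numbers, so \<open>x\<close>,
    possibly negative, is replaced by its residue modulo the absolute value of
    \<open>m\<close>.\<close>
  have x: "[int (nat (x mod N)) = x] (mod N)"
    using \<open>N > 0\<close> by (simp add: cong_def)
  have "coprime x (int N)"
    using assms by (simp add: N_def)
  then have "coprime (int (nat (x mod N))) (int N)"
    using cong_imp_coprime[OF cong_sym[OF x]] by blast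
  then have "coprime (nat (x mod N)) N"
    by (simp only: coprime_int_iff)
  then have "[nat (x mod N) ^ totient N = 1] (mod N)"
    by (rule euler_theorem)
  then have "[int (nat (x mod N)) ^ totient N = 1] (mod N)"
    by (metis cong_int_iff of_nat_1 of_nat_power)
  then have "[x ^ totient N = 1] (mod N)"
    using x cong_pow cong_trans cong_sym by blast
  then have "[x ^ totient N = 1] (mod m)"
    by (simp add: N_def cong_iff_dvd_diff)
  then show ?thesis
    using \<open>N > 0\<close> by (intro exI[of _ "totient N"]) simp
qed

lemma exists_monic_hom_eval_eq_1:
  assumes "finite S" "\<And>a b. (a, b) \<in> S \<Longrightarrow> b > 0 \<and> coprime a b"
  shows "\<exists>n f. n > 0 \<and> lead_coeff f = 1 \<and> degree f = n \<and> (\<forall>(a, b)\<in>S. hom_eval n f a b = 1)"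
  using assms
proof (induction S)
  case empty
  show ?case
    by (rule exI[of _ 1], rule exI[of _ "[:0, 1:]"]) simp
next
  case (insert p S)
  obtain a b where p: "p = (a, b)" by fastforce
  have ab: "b > 0" "coprime a b" using insert.prems p by auto
  have S: "d > 0" "coprime c d" if "(c, d) \<in> S" for c d
    using insert.prems that by auto
  obtain n f where nf: "n > 0" "lead_coeff f = 1" "degree f = n"
    and f1: "\<And>c d. (c, d) \<in> S \<Longrightarrow> hom_eval n f c d = 1"
    using insert.IH insert.prems by blast
  define m where "m = card S"
  define g where "g = (\<Prod>(c, d)\<in>S. [:- c, d:])"
  \<comment> \<open>\<open>A\<close> is the value of G at the new point. It is nonzero because that
    point differs from all those in \<open>S\<close>.\<close>
  define A where "A = b * (\<Prod>(c, d)\<in>S. d * a - c * b)"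
  have deg_g: "degree g \<le> m"
    unfolding g_def m_def by (rule degree_prod_linear_le)
  have g: "hom_eval m g x y = (\<Prod>(c, d)\<in>S. d * x - c * y)" if "y \<noteq> 0" for x y
    unfolding g_def m_def using insert.hyps(1) that by (rule hom_eval_prod_linear)
  have "coprime (hom_eval n f a b) A"
    unfolding A_def using nf ab S f1
    by (auto intro!: prod_coprime_right coprime_hom_eval_denominator coprime_hom_eval_determinant)
  moreover have "A \<noteq> 0"
    unfolding A_def using insert.hyps ab S primitive_points_eqI[of a b] p by fastforce
  ultimately obtain k where k: "k > 0" "[hom_eval n f a b ^ k = 1] (mod A)"
    using exists_power_cong_1 by blast
  \<comment> \<open>The factor \<open>Suc m\<close>, the degree of G, makes \<open>n * K\<close>
    large enough that the subtraction defining \<open>r\<close> is not truncated.\<close>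
  define K where "K = k * Suc m"
  have "[hom_eval n f a b ^ K = 1] (mod A)"
    unfolding K_def power_mult using cong_pow[OF k(2), of "Suc m"] by simp
  then obtain C where C: "hom_eval n f a b ^ K = 1 + C * A"
    by (metis cong_iff_dvd_diff dvd_def mult.commute diff_add_cancel add.commute)
  define r where "r = n * K - Suc m"
  have "1 * (1 * Suc m) \<le> n * (k * Suc m)"
    using nf(1) k(1) by (intro mult_le_mono) auto
  then have "Suc m \<le> n * K"
    unfolding K_def by simp
  then have r: "n * K = Suc (m + r)"
    unfolding r_def by simp
  obtain u v where uv: "v * b + u * a = 1"
    using ab(2) bezout_int[of a b] by (auto simp: coprime_iff_gcd_eq_1 add.commute)
  \<comment> \<open>\<open>h\<close> is G l^r with y set to 1. Read in degree \<open>n * K\<close>,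
    one more than the bound \<open>m + r\<close> on its degree, it regains the factor
    \<open>y\<close>.\<close>
  define h where "h = g * [:v, u:] ^ r"
  have deg_l: "degree ([:v, u:] ^ r) \<le> r"
    using order_trans[OF degree_power_le[of "[:v, u:]" r] mult_le_mono1[of _ 1]] by simp
  have deg_h: "degree h \<le> m + r"
    unfolding h_def using deg_g deg_l degree_mult_le[of g "[:v, u:] ^ r"] by linarith
  have h: "hom_eval (n * K) h x y = y * ((\<Prod>(c, d)\<in>S. d * x - c * y) * (v * y + u * x) ^ r)"
    if "y \<noteq> 0" for x y
  proof -
    have "hom_eval (1 * r) ([:v, u:] ^ r) x y = hom_eval 1 [:v, u:] x y ^ r"
      using that by (intro hom_eval_power) simp_all
    moreover have "hom_eval (m + r) h x y = hom_eval m g x y * hom_eval r ([:v, u:] ^ r) x y"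
      unfolding h_def using deg_g deg_l that by (rule hom_eval_mult)
    ultimately show ?thesis
      unfolding r hom_eval_Suc[OF deg_h] by (simp only: g[OF that] hom_eval_linear mult_1)
  qed
  define F where "F = f ^ K - Polynomial.smult C h"
  have F: "hom_eval (n * K) F x y = hom_eval n f x y ^ K
      - C * (y * ((\<Prod>(c, d)\<in>S. d * x - c * y) * (v * y + u * x) ^ r))" if "y \<noteq> 0" for x y
    unfolding F_def using nf that by (simp add: hom_eval_diff hom_eval_smult hom_eval_power h)
  have "f \<noteq> 0"
    using nf(2) by auto
  then have deg_fK: "degree (f ^ K) = n * K"
    using nf(3) by (metis degree_power_eq mult.commute)
  then have coeff_fK: "poly.coeff (f ^ K) (n * K) = 1"
    using nf(2) lead_coeff_power[of f K] by (metis power_one)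
  \<comment> \<open>The strict inequality reflects the factor \<open>y\<close> of G, which vanishes
    at (1, 0); it keeps \<open>F\<close> monic.\<close>
  have deg_Ch: "degree (Polynomial.smult C h) < n * K"
    unfolding r using order_trans[OF degree_smult_le deg_h] by (rule le_imp_less_Suc)
  have "degree F \<le> n * K"
    unfolding F_def using deg_fK deg_Ch by (intro degree_diff_le) simp_all
  moreover have coeff_F: "poly.coeff F (n * K) = 1"
    unfolding F_def coeff_diff coeff_fK coeff_eq_0[OF deg_Ch] by simp
  ultimately have "degree F = n * K"
    by (intro antisym le_degree) simp_all
  moreover note coeff_F
  \<comment> \<open>At the new point l is 1, so the value is (1 + C A) - C A.\<close>
  moreover have "hom_eval (n * K) F a b = 1"
    using ab(1) C uv by (subst F) (simp_all add: A_def)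
  moreover have "hom_eval (n * K) F x y = 1" if "(x, y) \<in> S" for x y
  proof -
    have "(\<Prod>(c, d)\<in>S. d * x - c * y) = 0"
      using insert.hyps(1) that by (intro prod_zero bexI[of _ "(x, y)"]) simp_all
    then show ?thesis
      using S(1)[OF that] f1[OF that] by (subst F) simp_all
  qed
  moreover have "n * K > 0"
    unfolding r by simp
  ultimately show ?case
    unfolding p by (intro exI[of _ "n * K"] exI[of _ F]) auto
qed

theorem theorem2p1:
  fixes k :: nat and a b :: "nat \<Rightarrow> int"
  assumes "\<And>i. i \<in> {1..k} \<Longrightarrow> b i > 0"
    and "\<And>i. i \<in> {1..k} \<Longrightarrow> gcd (a i) (b i) = 1"
  shows "\<exists>(n::nat) (f::int poly). n > 0 \<and> lead_coeff f = 1 \<and> degree f = n \<and>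
    (\<forall>i\<in>{1..k}. poly (map_poly of_int f) (of_int (a i) / of_int (b i) :: rat)
       = 1 / of_int (b i) ^ n)"
proof -
  \<comment> \<open>Passing to the set of pairs removes repetitions, so that each point added in the
    induction is new.\<close>
  have "\<exists>n f. n > 0 \<and> lead_coeff f = 1 \<and> degree f = n \<and>
      (\<forall>(x, y)\<in>(\<lambda>i. (a i, b i)) ` {1..k}. hom_eval n f x y = 1)"
    using assms by (intro exists_monic_hom_eval_eq_1) (auto simp: coprime_iff_gcd_eq_1)
  then obtain n f where nf: "n > 0" "lead_coeff f = 1" "degree f = n"
    and f1: "\<And>i. i \<in> {1..k} \<Longrightarrow> hom_eval n f (a i) (b i) = 1"
    by blast
  have "poly (map_poly of_int f) (of_int (a i) / of_int (b i) :: rat) = 1 / of_int (b i) ^ n"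
    if "i \<in> {1..k}" for i
    using of_int_hom_eval[of f n "b i" "a i"] nf(3) f1[OF that] assms(1)[OF that]
    by (simp add: field_simps)
  then show ?thesis
    using nf by blast
qed

end
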